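(* Let $G$ be a simple graph on $[n]$, let $I_G\subseteq\mathbb{R}[x_1,\dots,x_n]$ be generated by the monomials $x_ix_j$ with $i\neq j$ and $\{i,j\}$ not an edge of $G$, and let $X_G=\mathbb{V}(I_G)\subseteq\mathbb{P}^{n-1}$. Then the Hankel index $\eta(X_G)$ equals the smallest integer $p\geq2$ such that $G$ contains an induced cycle of length $p+2$ (and $\eta(X_G)=\infty$ if $G$ has no induced cycle of length $\geq4$).
   Context: $R=\mathbb{R}[x_1,\dots,x_n]/I_G$; $\Sigma_{X_G}\subseteq R_2$ is the cone of sums of squares of elements of $R_1$, with dual cone $\Sigma_{X_G}^*$ regarded inside $\mathbb{R}[x_1,\dots,x_n]_2^*$. For $\ell$ in that space, its rank is the rank of the bilinear form $(f,g)\mapsto\ell(fg)$ on linear forms. The Hankel index $\eta(X)$ is the smallest integer $p>1$ such that $\Sigma_X^*$ has an extreme ray of rank $p$, and $\infty$ if all extreme rays have rank $1$. An induced cycle is a cycle which is an induced subgraph (chordless). *)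

theory Defs
  imports "HOL-Analysis.Analysis" "HOL-Library.Extended_Nat"
begin

definition simple_graph :: "('n \<Rightarrow> 'n \<Rightarrow> bool) \<Rightarrow> bool" where
  "simple_graph E \<longleftrightarrow> (\<forall>i j. E i j \<longleftrightarrow> E j i) \<and> (\<forall>i. \<not> E i i)"

(* A linear functional ell on R[x_1..x_n]_2 is encoded by its values on the
   monomial basis: L $ i $ j = ell(x_i x_j), so L is symmetric.
   A linear form f = sum_i f$i x_i is encoded by its coefficient vector. *)
definition ell_prod :: "real^'n^'n \<Rightarrow> real^'n \<Rightarrow> real^'n \<Rightarrow> real" where
  "ell_prod L f g = (\<Sum>i\<in>UNIV. \<Sum>j\<in>UNIV. f$i * g$j * L$i$j)"

definition quad_functional :: "real^'n^'n \<Rightarrow> bool" where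
  "quad_functional L \<longleftrightarrow> (\<forall>i j. L$i$j = L$j$i)"

(* The dual cone Sigma_{X_G}^*, regarded inside R[x]_2^*: functionals that
   vanish on (I_G)_2 (spanned by x_i x_j, i \<noteq> j, {i,j} not an edge) and
   are nonnegative on every sum of squares of linear forms. *)
definition sos_dual_cone :: "('n \<Rightarrow> 'n \<Rightarrow> bool) \<Rightarrow> (real^'n^'n) set" where
  "sos_dual_cone E = {L. quad_functional L
      \<and> (\<forall>i j. i \<noteq> j \<and> \<not> E i j \<longrightarrow> L$i$j = 0)
      \<and> (\<forall>fs :: (real^'n) list. 0 \<le> (\<Sum>f\<leftarrow>fs. ell_prod L f f))}"

(* Rank of ell: rank of the bilinear form (f,g) |-> ell(fg), whose Gram
   matrix in the standard basis is L. *)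
definition functional_rank :: "real^'n^'n \<Rightarrow> nat" where
  "functional_rank L = rank L"

definition extreme_ray :: "(real^'n^'n) set \<Rightarrow> real^'n^'n \<Rightarrow> bool" where
  "extreme_ray K L \<longleftrightarrow> L \<in> K \<and> L \<noteq> 0 \<and>
     (\<forall>A\<in>K. \<forall>B\<in>K. A + B = L \<longrightarrow>
        (\<exists>s\<ge>0. A = s *\<^sub>R L) \<and> (\<exists>t\<ge>0. B = t *\<^sub>R L))"

definition hankel_index :: "('n::finite \<Rightarrow> 'n \<Rightarrow> bool) \<Rightarrow> enat" where
  "hankel_index E =
     (if \<exists>p>1. \<exists>L. extreme_ray (sos_dual_cone E) L \<and> functional_rank L = p
      then enat (LEAST p. p > 1 \<and> (\<exists>L. extreme_ray (sos_dual_cone E) L \<and> functional_rank L = p))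
      else \<infinity>)"

definition has_induced_cycle :: "('n \<Rightarrow> 'n \<Rightarrow> bool) \<Rightarrow> nat \<Rightarrow> bool" where
  "has_induced_cycle E k \<longleftrightarrow> k \<ge> 3 \<and> (\<exists>c :: nat \<Rightarrow> 'n. inj_on c {..<k} \<and>
     (\<forall>i<k. \<forall>j<k. i \<noteq> j \<longrightarrow>
        (E (c i) (c j) \<longleftrightarrow> (j = (i + 1) mod k \<or> i = (j + 1) mod k))))"

end

theory Submission
  imports Defs "HOL-Number_Theory.Cong"
begin

text \<open>Elements of the dual cone are the positive semidefinite matrices whose off-diagonal support
  lies in \<open>E\<close>.

  An induced cycle on \<open>x\<^sub>0, \<dots>, x\<^sub>p\<^sub>+\<^sub>1\<close> gives the form
  \<open>\<Sum>k<p. (x\<^sub>k - x\<^sub>k\<^sub>+\<^sub>1 + x\<^sub>p\<^sub>+\<^sub>1)\<^sup>2\<close> of rank \<open>p\<close>; it is extreme because its two-dimensional kernel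
  determines a form supported on the cycle up to a scalar.

  Conversely, suppose that \<open>L\<close> has rank \<open>p\<close> and that \<open>E\<close> has no induced cycle with length
  between \<open>4\<close> and \<open>p + 2\<close>. Then the column space of \<open>L\<close> contains a nonzero vector \<open>x\<close> supported
  on a clique, so a multiple of \<open>x x\<^sup>T\<close> splits off from \<open>L\<close>, and an extreme \<open>L\<close> has rank \<open>1\<close>. The
  vector \<open>x\<close> is found by induction on \<open>p\<close>: a Schur complement at a vertex \<open>v\<close> lowers the rank by
  one, and the graph in which \<open>v\<close> is eliminated and \<open>N(v)\<close> is made a clique has no induced cycle
  with length between \<open>4\<close> and \<open>p + 1\<close>. A clique of the new graph that is not contained in \<open>N(v)\<close>
  is already a clique of \<open>E\<close>, since \<open>E\<close> has no induced \<open>4\<close>-cycle.\<close>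

section \<open>Dual cone elements as positive semidefinite matrices\<close>

lemma ell_prod_eq_inner: "ell_prod L f g = f \<bullet> (L *v g)"
  by (simp add: ell_prod_def inner_vec_def matrix_vector_mult_def sum_distrib_left mult_ac)

definition psd :: "real^'n^'n \<Rightarrow> bool" where
  "psd L \<longleftrightarrow> quad_functional L \<and> (\<forall>f. 0 \<le> f \<bullet> (L *v f))"

definition supported_on :: "('n \<Rightarrow> 'n \<Rightarrow> bool) \<Rightarrow> real^'n^'n \<Rightarrow> bool" where
  "supported_on E L \<longleftrightarrow> (\<forall>i j. i \<noteq> j \<longrightarrow> \<not> E i j \<longrightarrow> L$i$j = 0)"

lemma mem_sos_dual_cone_iff: "L \<in> sos_dual_cone E \<longleftrightarrow> psd L \<and> supported_on E L"
proof -
  have "(\<forall>fs. 0 \<le> (\<Sum>f\<leftarrow>fs. f \<bullet> (L *v f))) \<longleftrightarrow> (\<forall>f. 0 \<le> f \<bullet> (L *v f))"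
  proof safe
    fix f assume "\<forall>fs. 0 \<le> (\<Sum>f\<leftarrow>fs. f \<bullet> (L *v f))"
    from this[rule_format, of "[f]"] show "0 \<le> f \<bullet> (L *v f)" by simp
  next
    fix fs assume "\<forall>f. 0 \<le> f \<bullet> (L *v f)"
    then show "0 \<le> (\<Sum>f\<leftarrow>fs. f \<bullet> (L *v f))" by (intro sum_list_nonneg) auto
  qed
  then show ?thesis
    by (auto simp: sos_dual_cone_def psd_def supported_on_def ell_prod_eq_inner)
qed

lemma quad_functional_inner_commute:
  assumes "quad_functional L"
  shows "f \<bullet> (L *v g) = g \<bullet> (L *v f)"
proof -
  have "transpose L = L"
    using assms by (simp add: quad_functional_def transpose_def vec_eq_iff)
  then show ?thesis
    by (metis dot_lmul_matrix inner_commute transpose_matrix_vector)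
qed

lemma psd_Cauchy_Schwarz:
  assumes "psd L"
  shows "(f \<bullet> (L *v g))\<^sup>2 \<le> (f \<bullet> (L *v f)) * (g \<bullet> (L *v g))"
proof -
  define a b c where "a = f \<bullet> (L *v f)" and "b = f \<bullet> (L *v g)" and "c = g \<bullet> (L *v g)"
  have comm: "g \<bullet> (L *v f) = b"
    using assms unfolding psd_def b_def by (metis quad_functional_inner_commute)
  have nn: "0 \<le> s\<^sup>2 * a + 2 * s * t * b + t\<^sup>2 * c" for s t
  proof -
    have "0 \<le> (s *\<^sub>R f + t *\<^sub>R g) \<bullet> (L *v (s *\<^sub>R f + t *\<^sub>R g))"
      using assms by (simp add: psd_def)
    also have "\<dots> = s\<^sup>2 * a + 2 * s * t * b + t\<^sup>2 * c"
      by (simp add: matrix_vector_right_distrib matrix_vector_mult_scaleR inner_add_left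
          inner_add_right comm a_def[symmetric] b_def[symmetric] c_def[symmetric]
          power2_eq_square algebra_simps)
    finally show ?thesis .
  qed
  have a0: "0 \<le> a" and c0: "0 \<le> c" using assms by (auto simp: psd_def a_def c_def)
  show ?thesis
  proof (cases "c = 0")
    case True
    have "b = 0"
    proof (rule ccontr)
      assume b: "b \<noteq> 0"
      \<comment> \<open>For \<open>c = 0\<close> and \<open>s = 1\<close> the form is affine in
        \<open>t\<close> with slope \<open>2 * b\<close>; this \<open>t\<close> gives it the value
        \<open>-1\<close>.\<close>
      have "0 \<le> a + 2 * (- (a + 1) / (2 * b)) * b"
        using nn[of 1 "- (a + 1) / (2 * b)"] True by simp
      also have "\<dots> = -1" using b by (simp add: field_simps)
      finally show False by simp
    qed
    then show ?thesis using True by (simp add: a_def b_def c_def)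
  next
    case False
    \<comment> \<open>The form is evaluated at \<open>c f - b g\<close>, a multiple of the component
      of \<open>f\<close> that is \<open>L\<close>-orthogonal to \<open>g\<close>.\<close>
    have "0 \<le> c * (a * c - b\<^sup>2)"
      using nn[of c "-b"] by (simp add: power2_eq_square algebra_simps)
    then have "b\<^sup>2 \<le> a * c"
      using False c0 by (simp add: zero_le_mult_iff)
    then show ?thesis by (simp add: a_def b_def c_def)
  qed
qed

text \<open>Cauchy-Schwarz against \<open>L *v f\<close> itself bounds the norm of
  \<open>L *v f\<close> by zero when \<open>f\<close> is isotropic.\<close>

lemma psd_kernel_iff:
  assumes "psd L"
  shows "L *v f = 0 \<longleftrightarrow> f \<bullet> (L *v f) = 0"
proof
  assume "f \<bullet> (L *v f) = 0"
  then have "((L *v f) \<bullet> (L *v f))\<^sup>2 \<le> 0"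
    using psd_Cauchy_Schwarz[OF assms, of "L *v f" f] by simp
  then show "L *v f = 0" by simp
qed simp

lemma axis_inner_matrix_axis: "axis i 1 \<bullet> (L *v axis j 1) = (L :: real^'n^'n) $ i $ j"
  by (simp add: inner_axis' matrix_vector_mul_component inner_axis)

lemma psd_diag_nonneg: "psd L \<Longrightarrow> 0 \<le> L $ i $ i"
  by (metis axis_inner_matrix_axis psd_def)

lemma psd_zero_diag_imp_zero_component:
  assumes "psd L" "L $ i $ i = 0"
  shows "(L *v f) $ i = 0"
proof -
  have "L *v axis i 1 = 0"
    using assms by (simp add: psd_kernel_iff axis_inner_matrix_axis)
  then have "axis i 1 \<bullet> (L *v f) = 0"
    using assms(1) quad_functional_inner_commute[of L "axis i 1" f] by (simp add: psd_def)
  then show ?thesis by (simp add: inner_axis')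
qed

text \<open>As a functional, this is evaluation of quadratic forms at the point
  \<open>x\<close>.\<close>

definition outer :: "real^'n \<Rightarrow> real^'n^'n" where
  "outer x = (\<chi> i j. x$i * x$j)"

lemma outer_nth [simp]: "outer x $ i $ j = x$i * x$j"
  by (simp add: outer_def)

lemma outer_mult: "outer x *v f = (x \<bullet> f) *\<^sub>R x"
  by (simp add: vec_eq_iff matrix_vector_mult_def inner_vec_def sum_distrib_left mult_ac)

lemma psd_scaleR_outer: "0 \<le> c \<Longrightarrow> psd (c *\<^sub>R outer x)"
  by (simp add: psd_def quad_functional_def scaleR_matrix_vector_assoc[symmetric] outer_mult
      inner_commute mult_ac)

text \<open>Nonnegativity of the remainder is Cauchy-Schwarz against \<open>y\<close>;
  \<open>c\<close> is the value at which the remainder annihilates \<open>y\<close>.\<close>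

lemma psd_split_outer:
  assumes "psd L" and "L *v y \<noteq> 0"
  defines "c \<equiv> inverse (y \<bullet> (L *v y))"
  shows "0 < c" "psd (L - c *\<^sub>R outer (L *v y))"
proof -
  have "y \<bullet> (L *v y) > 0"
    using assms psd_kernel_iff[of L y] by (metis less_eq_real_def psd_def)
  then show c: "0 < c" by (simp add: c_def)
  have *: "f \<bullet> ((L - c *\<^sub>R outer (L *v y)) *v f) = f \<bullet> (L *v f) - c * (f \<bullet> (L *v y))\<^sup>2" for f
    by (simp add: matrix_vector_mult_diff_rdistrib scaleR_matrix_vector_assoc[symmetric] outer_mult
        inner_diff_right inner_commute power2_eq_square)
  have "c * (f \<bullet> (L *v y))\<^sup>2 \<le> f \<bullet> (L *v f)" for f
    using psd_Cauchy_Schwarz[OF assms(1), of f y] \<open>y \<bullet> (L *v y) > 0\<close>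
    by (simp add: c_def field_simps)
  with assms(1) show "psd (L - c *\<^sub>R outer (L *v y))"
    unfolding psd_def * by (auto simp: quad_functional_def)
qed


section \<open>Vertex elimination and induced cycles\<close>

definition clique :: "('n \<Rightarrow> 'n \<Rightarrow> bool) \<Rightarrow> 'n set \<Rightarrow> bool" where
  "clique E K \<longleftrightarrow> (\<forall>a\<in>K. \<forall>b\<in>K. a \<noteq> b \<longrightarrow> E a b)"

text \<open>\<open>v\<close> stays as an isolated vertex, so the vertex type does not change.
  Joining its neighbours is the fill-in of Gaussian elimination at \<open>v\<close>.\<close>

definition eliminate :: "('n \<Rightarrow> 'n \<Rightarrow> bool) \<Rightarrow> 'n \<Rightarrow> 'n \<Rightarrow> 'n \<Rightarrow> bool" where
  "eliminate E v a b \<longleftrightarrow> a \<noteq> v \<and> b \<noteq> v \<and> a \<noteq> b \<and> (E a b \<or> E v a \<and> E v b)"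

lemma simple_graph_eliminate: "simple_graph E \<Longrightarrow> simple_graph (eliminate E v)"
  unfolding simple_graph_def eliminate_def by metis

text \<open>For \<open>i < j\<close> the only wraparound is the closing edge from
  \<open>k - 1\<close> to \<open>0\<close>, so \<open>mod\<close> disappears.\<close>

lemma has_induced_cycle_iff_increasing:
  assumes "simple_graph E"
  shows "has_induced_cycle E k \<longleftrightarrow> k \<ge> 3 \<and> (\<exists>c. inj_on c {..<k} \<and>
    (\<forall>i j. i < j \<longrightarrow> j < k \<longrightarrow> (E (c i) (c j) \<longleftrightarrow> j = i + 1 \<or> i = 0 \<and> j = k - 1)))"
proof -
  have sym: "E a b \<longleftrightarrow> E b a" for a b using assms by (auto simp: simple_graph_def)
  have *: "j = (i + 1) mod k \<or> i = (j + 1) mod k \<longleftrightarrow> j = i + 1 \<or> i = 0 \<and> j = k - 1"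
    if "i < j" "j < k" for i j
  proof -
    have "(i + 1) mod k = i + 1" using that by simp
    moreover have "(j + 1) mod k = (if j = k - 1 then 0 else j + 1)"
      using that by (auto simp: mod_less)
    ultimately show ?thesis using that by auto
  qed
  have "(\<forall>i<k. \<forall>j<k. i \<noteq> j \<longrightarrow> (E (c i) (c j) \<longleftrightarrow> (j = (i + 1) mod k \<or> i = (j + 1) mod k)))
    \<longleftrightarrow> (\<forall>i j. i < j \<longrightarrow> j < k \<longrightarrow> (E (c i) (c j) \<longleftrightarrow> j = i + 1 \<or> i = 0 \<and> j = k - 1))"
    (is "?L \<longleftrightarrow> ?R") for c
  proof
    assume L: ?L
    show ?R
    proof (intro allI impI)
      fix i j assume ij: "i < j" "j < k"
      then have "E (c i) (c j) \<longleftrightarrow> (j = (i + 1) mod k \<or> i = (j + 1) mod k)"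
        using L by simp
      with *[OF ij] show "E (c i) (c j) \<longleftrightarrow> j = i + 1 \<or> i = 0 \<and> j = k - 1" by blast
    qed
  next
    assume R: ?R
    show ?L
    proof (intro allI impI)
      fix i j assume "i < k" "j < k" "i \<noteq> j"
      then consider "i < j" | "j < i" by linarith
      then show "E (c i) (c j) \<longleftrightarrow> (j = (i + 1) mod k \<or> i = (j + 1) mod k)"
      proof cases
        case 1
        then show ?thesis unfolding *[OF 1 \<open>j < k\<close>] using R \<open>j < k\<close> by simp
      next
        case 2
        have "E (c i) (c j) \<longleftrightarrow> E (c j) (c i)" by (rule sym)
        also have "\<dots> \<longleftrightarrow> i = j + 1 \<or> j = 0 \<and> i = k - 1" using R 2 \<open>i < k\<close> by simp
        finally show ?thesis using *[OF 2 \<open>i < k\<close>] by argo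
      qed
    qed
  qed
  then show ?thesis by (simp add: has_induced_cycle_def)
qed

lemma has_induced_4_cycleI:
  assumes E: "simple_graph E" and e: "E a b" "E b c" "E c d" "E d a"
    and "\<not> E a c" "\<not> E b d" "a \<noteq> c" "b \<noteq> d"
  shows "has_induced_cycle E 4"
proof -
  define f where "f = (\<lambda>i::nat. if i = 0 then a else if i = 1 then b else if i = 2 then c else d)"
  have ne: "a \<noteq> b" "b \<noteq> c" "c \<noteq> d" "a \<noteq> d" using E e by (auto simp: simple_graph_def)
  have less4: "i < 4 \<longleftrightarrow> i = 0 \<or> i = 1 \<or> i = 2 \<or> i = (3::nat)" for i by auto
  have "inj_on f {..<4}"
    using ne assms by (auto simp: inj_on_def f_def less4)
  moreover have "E (f i) (f j) \<longleftrightarrow> j = i + 1 \<or> i = 0 \<and> j = 3" if "i < j" "j < 4" for i j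
  proof -
    have "E a d" using E e by (auto simp: simple_graph_def)
    then show ?thesis
      using that assms by (auto simp: f_def less4)
  qed
  ultimately show ?thesis
    by (auto simp: has_induced_cycle_iff_increasing[OF E] intro!: exI[of _ f])
qed

lemma induced_cycle_rotate:
  fixes k s :: nat
  assumes "0 < k" "inj_on c {..<k}"
    and "\<forall>i<k. \<forall>j<k. i \<noteq> j \<longrightarrow> (E (c i) (c j) \<longleftrightarrow> (j = (i + 1) mod k \<or> i = (j + 1) mod k))"
  defines "d \<equiv> \<lambda>i. c ((s + i) mod k)"
  shows "inj_on d {..<k}"
    and "\<forall>i<k. \<forall>j<k. i \<noteq> j \<longrightarrow> (E (d i) (d j) \<longleftrightarrow> (j = (i + 1) mod k \<or> i = (j + 1) mod k))"
proof -
  have cancel: "(s + i) mod k = (s + j) mod k \<longleftrightarrow> i mod k = j mod k" for i j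
    using cong_add_lcancel_nat[of s i j k] by (simp add: cong_def)
  show "inj_on d {..<k}"
  proof (rule inj_onI)
    fix i j assume *: "i \<in> {..<k}" "j \<in> {..<k}" "d i = d j"
    then have "(s + i) mod k = (s + j) mod k"
      using assms(1,2) by (auto simp: d_def inj_on_def)
    then show "i = j" using * by (simp add: cancel)
  qed
  show "\<forall>i<k. \<forall>j<k. i \<noteq> j \<longrightarrow> (E (d i) (d j) \<longleftrightarrow> (j = (i + 1) mod k \<or> i = (j + 1) mod k))"
  proof (intro allI impI)
    fix i j assume ij: "i < k" "j < k" "i \<noteq> j"
    have step: "(s + j) mod k = ((s + i) mod k + 1) mod k \<longleftrightarrow> j = (i + 1) mod k"
      if "j < k" for i j
      using cancel[of j "i + 1"] that by (simp add: mod_simps)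
    have "(s + i) mod k \<noteq> (s + j) mod k" using ij by (simp add: cancel)
    then show "E (d i) (d j) \<longleftrightarrow> (j = (i + 1) mod k \<or> i = (j + 1) mod k)"
      using assms(1,3) step[of j i] step[of i j] ij by (simp add: d_def)
  qed
qed

text \<open>The vertices of \<open>N(v)\<close> form a clique after elimination, so an induced cycle of length at
  least \<open>4\<close> contains at most one fill-in edge, which can be subdivided by \<open>v\<close>.\<close>

lemma has_induced_cycle_eliminateD:
  assumes E: "simple_graph E" and cyc: "has_induced_cycle (eliminate E v) k" and k: "4 \<le> k"
  shows "has_induced_cycle E k \<or> has_induced_cycle E (k + 1)"
proof -
  let ?F = "eliminate E v"
  have sym: "E a b \<longleftrightarrow> E b a" for a b using E by (auto simp: simple_graph_def)
  obtain c where c: "inj_on c {..<k}"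
    "\<forall>i<k. \<forall>j<k. i \<noteq> j \<longrightarrow> (?F (c i) (c j) \<longleftrightarrow> (j = (i + 1) mod k \<or> i = (j + 1) mod k))"
    using cyc unfolding has_induced_cycle_def by blast
  show ?thesis
  proof (cases "\<forall>i<k. E (c i) (c ((i + 1) mod k))")
    case True
    have "E (c i) (c j) \<longleftrightarrow> ?F (c i) (c j)" if ij: "i < k" "j < k" "i \<noteq> j" for i j
    proof
      assume "?F (c i) (c j)"
      then show "E (c i) (c j)" using c(2) ij True sym by metis
    next
      \<comment> \<open>Every cycle vertex lies on an edge of \<open>?F\<close> and hence differs
        from \<open>v\<close>; edges of \<open>E\<close> that avoid \<open>v\<close> survive
        elimination.\<close>
      have F: "?F (c l) (c ((l + 1) mod k))" if "l < k" for l
      proof -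
        have "(l + 1) mod k \<noteq> l" using k that by (cases "l + 1 = k") auto
        then show ?thesis using c(2) that k by simp
      qed
      assume "E (c i) (c j)"
      then show "?F (c i) (c j)"
        using F[OF ij(1)] F[OF ij(2)] E by (auto simp: eliminate_def simple_graph_def)
    qed
    then have "has_induced_cycle E k"
      using c k unfolding has_induced_cycle_def by auto
    then show ?thesis ..
  next
    case False
    then obtain m where m: "m < k" "\<not> E (c m) (c ((m + 1) mod k))" by blast
    \<comment> \<open>The cycle is rotated so that the fill-in edge becomes the closing edge from
      \<open>d (k - 1)\<close> to \<open>d 0\<close>.\<close>
    define d where "d = (\<lambda>i. c ((m + 1 + i) mod k))"
    have dinj: "inj_on d {..<k}"
      and d': "\<forall>i<k. \<forall>j<k. i \<noteq> j \<longrightarrow> (?F (d i) (d j) \<longleftrightarrow> (j = (i + 1) mod k \<or> i = (j + 1) mod k))"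
      unfolding d_def using induced_cycle_rotate[OF _ c, of "m + 1"] k by auto
    have d: "?F (d i) (d j) \<longleftrightarrow> j = i + 1 \<or> i = 0 \<and> j = k - 1" if "i < j" "j < k" for i j
    proof -
      have "(i + 1) mod k = i + 1" using that by simp
      moreover have "(j + 1) mod k = (if j = k - 1 then 0 else j + 1)"
        using that by (auto simp: mod_less)
      ultimately show ?thesis
        using that d' by auto
    qed
    have d0: "d 0 = c ((m + 1) mod k)" by (simp add: d_def)
    have "(m + 1 + (k - 1)) mod k = m" using m(1) k by simp
    then have dlast: "d (k - 1) = c m" by (simp add: d_def)
    have ends: "?F (d 0) (d (k - 1))" using d[of 0 "k - 1"] k by simp
    have v_ends: "E v (d 0)" "E v (d (k - 1))"
      using ends m(2) sym[of "d 0" "d (k - 1)"] unfolding eliminate_def d0[symmetric] dlast[symmetric]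
      by blast+
    have dv: "d i \<noteq> v" if "i < k" for i
    proof (cases "i = k - 1")
      case True then show ?thesis using ends by (simp add: eliminate_def)
    next
      case False
      then have "?F (d i) (d (i + 1))" using d[of i "i + 1"] that by simp
      then show ?thesis by (simp add: eliminate_def)
    qed
    \<comment> \<open>A further neighbour of \<open>v\<close> on the cycle would form a triangle of
      \<open>?F\<close> with \<open>d 0\<close> and \<open>d (k - 1)\<close>, impossible for
      \<open>k \<ge> 4\<close>.\<close>
    have inner: "\<not> E v (d i)" if "0 < i" "i < k - 1" for i
    proof
      assume "E v (d i)"
      moreover have "i < k" using that by simp
      then have "d i \<noteq> d 0" "d i \<noteq> d (k - 1)"
        using inj_onD[OF dinj, of i 0] inj_onD[OF dinj, of i "k - 1"] that k by auto
      ultimately have "?F (d 0) (d i)" "?F (d i) (d (k - 1))"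
        using v_ends dv that k by (auto simp: eliminate_def)
      then show False using d[of 0 i] d[of i "k - 1"] that k by auto
    qed
    \<comment> \<open>\<open>v\<close> is inserted at position \<open>k\<close>, between
      \<open>d (k - 1)\<close> and \<open>d 0\<close>.\<close>
    define f where "f = (\<lambda>i. if i < k then d i else v)"
    have "inj_on f {..<k + 1}"
      unfolding inj_on_def f_def
    proof (intro ballI impI)
      fix i j
      assume "i \<in> {..<k + 1}" "j \<in> {..<k + 1}" "(if i < k then d i else v) = (if j < k then d j else v)"
      then show "i = j"
        using dinj dv[of i] dv[of j] by (auto simp: inj_on_def split: if_splits)
    qed
    moreover have "E (f i) (f j) \<longleftrightarrow> j = i + 1 \<or> i = 0 \<and> j = k" if ij: "i < j" "j < k + 1" for i j
    proof (cases "j = k")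
      case True
      have "E v (d i) \<longleftrightarrow> i = 0 \<or> i = k - 1"
      proof -
        have "i = 0 \<or> i = k - 1 \<or> 0 < i \<and> i < k - 1" using ij True by linarith
        then show ?thesis using v_ends inner by auto
      qed
      then show ?thesis using ij True sym k by (auto simp: f_def)
    next
      case False
      then have jk: "j < k" using ij by simp
      have "E (d i) (d j) \<longleftrightarrow> j = i + 1"
      proof
        assume e: "E (d i) (d j)"
        have "d i \<noteq> d j" using dinj ij jk by (auto simp: inj_on_def)
        then have "?F (d i) (d j)" using e dv ij jk by (auto simp: eliminate_def)
        then show "j = i + 1"
          using d[OF ij(1) jk] e m(2) sym[of "d 0" "d (k - 1)"]
          unfolding d0[symmetric] dlast[symmetric] by blast
      next
        assume j: "j = i + 1"
        then have "?F (d i) (d j)" using d[OF ij(1) jk] by simp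
        moreover have "\<not> (E v (d i) \<and> E v (d j))"
          using inner[of i] inner[of j] j jk k by (cases "i = 0") auto
        ultimately show "E (d i) (d j)" by (auto simp: eliminate_def)
      qed
      then show ?thesis using ij jk by (simp add: f_def)
    qed
    ultimately have "has_induced_cycle E (k + 1)"
      unfolding has_induced_cycle_iff_increasing[OF E] using k by (auto intro!: exI[of _ f])
    then show ?thesis ..
  qed
qed


section \<open>Schur complements and clique-supported vectors\<close>

lemma rank_le_0_imp_zero: "rank L \<le> 0 \<Longrightarrow> L = 0" for L :: "real^'n^'m"
  by (simp add: rank_eq_0)

text \<open>This puts the column space of a Schur complement inside that of \<open>L\<close>, so a
  vector found after elimination also serves for \<open>L\<close>.\<close>

lemma schur_complement_mult:
  "(L - c *\<^sub>R outer (L *v y)) *v f = L *v (f - (c * ((L *v y) \<bullet> f)) *\<^sub>R y)"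
  by (simp add: matrix_vector_mult_diff_rdistrib scaleR_matrix_vector_assoc[symmetric] outer_mult
      matrix_vector_mult_diff_distrib matrix_vector_mult_scaleR)

text \<open>The column space shrinks strictly: all vectors in that of \<open>M\<close> vanish at
  \<open>i\<close>, whereas column \<open>i\<close> of \<open>L\<close> does not.\<close>

lemma rank_schur_complement_less:
  fixes L :: "real^'n^'n"
  assumes "psd L" "L$i$i \<noteq> 0"
  defines "M \<equiv> L - inverse (L$i$i) *\<^sub>R outer (L *v axis i 1)"
  shows "rank M < rank L" "(M *v f) $ i = 0"
proof -
  have col: "(L *v axis i 1) $ a = L$a$i" for a
    by (simp add: matrix_vector_mult_basis column_def)
  have sym: "L$a$b = L$b$a" for a b using assms(1) by (simp add: psd_def quad_functional_def)
  show zero: "(M *v f) $ i = 0" for f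
  proof -
    have "(L *v axis i 1) \<bullet> f = (L *v f) $ i"
      by (simp add: inner_vec_def matrix_vector_mult_def[of L f] col sym[of _ i])
    then have "(M *v f) $ i = (L *v f)$i - inverse (L$i$i) * (L *v f)$i * L$i$i"
      by (simp add: M_def matrix_vector_mult_diff_rdistrib scaleR_matrix_vector_assoc[symmetric]
          outer_mult col)
    then show ?thesis using assms(2) by simp
  qed
  have "range (\<lambda>f. M *v f) \<subseteq> range (\<lambda>f. L *v f)"
    by (auto simp: M_def schur_complement_mult)
  moreover have "L *v axis i 1 \<in> range (\<lambda>f. L *v f) - range (\<lambda>f. M *v f)"
    using zero col[of i] assms(2) by (metis Diff_iff rangeE rangeI)
  ultimately have "range (\<lambda>f. M *v f) \<subset> range (\<lambda>f. L *v f)" by blast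
  moreover have "subspace (range (\<lambda>f. A *v f))" for A :: "real^'n^'n"
    by (simp add: linear_subspace_image matrix_vector_mul_linear)
  ultimately have "dim (range (\<lambda>f. M *v f)) < dim (range (\<lambda>f. L *v f))"
    by (metis dim_psubset span_eq_iff)
  then show "rank M < rank L" by (simp add: rank_dim_range)
qed

text \<open>An analogue of Dirac's theorem that a chordal graph has a simplicial vertex outside any
  given clique that misses a vertex: for chordal \<open>E\<close>, the column of \<open>L\<close> at a simplicial
  vertex is such an \<open>L *v y\<close>.\<close>

lemma psd_ex_clique_supported:
  fixes E :: "'n::finite \<Rightarrow> 'n \<Rightarrow> bool"
  assumes "simple_graph E" "psd L" "supported_on E L" "rank L \<le> p"
    and "\<And>k. 4 \<le> k \<Longrightarrow> k \<le> p + 2 \<Longrightarrow> \<not> has_induced_cycle E k"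
    and "clique E C" "j \<notin> C" "L$j$j \<noteq> 0"
  shows "\<exists>y. clique E {a. (L *v y)$a \<noteq> 0} \<and> \<not> {a. (L *v y)$a \<noteq> 0} \<subseteq> C"
  using assms
proof (induction p arbitrary: E L C j)
  case 0
  then show ?case using rank_le_0_imp_zero[of L] by simp
next
  case (Suc p)
  note E = Suc.prems(1) and psd = Suc.prems(2) and supp = Suc.prems(3)
  have sym: "E a b \<longleftrightarrow> E b a" and irr: "\<not> E a a" for a b
    using E by (auto simp: simple_graph_def)
  have diag: "L$a$a \<noteq> 0" if "(L *v y)$a \<noteq> 0" for a y
    using psd_zero_diag_imp_zero_component[OF psd] that by blast
  \<comment> \<open>Rows with zero diagonal entry vanish, so only vertices with nonzero diagonal
    entry count. Without a non-adjacent pair among them, every column is supported on a clique, and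
    column \<open>j\<close> leaves \<open>C\<close>.\<close>
  define nonuniv where "nonuniv i \<longleftrightarrow> L$i$i \<noteq> 0 \<and> (\<exists>b. b \<noteq> i \<and> \<not> E i b \<and> L$b$b \<noteq> 0)" for i
  show ?case
  proof (cases "\<exists>i. nonuniv i")
    case False
    then have "clique E {a. (L *v axis j 1)$a \<noteq> 0}"
      using diag sym unfolding clique_def nonuniv_def by blast
    moreover have "(L *v axis j 1)$j \<noteq> 0"
      using Suc.prems(8) axis_inner_matrix_axis[of j L j] by (simp add: inner_axis')
    ultimately show ?thesis using Suc.prems(7) by blast
  next
    case True
    \<comment> \<open>The pivot is taken in \<open>C\<close> whenever possible. This later keeps the
      vertex \<open>c\<close>, which is not adjacent to \<open>i\<close>, out of the clique
      \<open>C\<close>.\<close>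
    then obtain i where i: "nonuniv i" "(\<exists>i\<in>C. nonuniv i) \<Longrightarrow> i \<in> C" by metis
    from i(1) obtain b where Lii: "L$i$i \<noteq> 0" and b: "b \<noteq> i" "\<not> E i b" "L$b$b \<noteq> 0"
      unfolding nonuniv_def by blast
    let ?F = "eliminate E i"
    define M where "M = L - inverse (L$i$i) *\<^sub>R outer (L *v axis i 1)"
    have col: "(L *v axis i 1) $ a = L$a$i" for a
      by (simp add: matrix_vector_mult_basis column_def)
    have Lsym: "L$a$b = L$b$a" for a b using psd by (simp add: psd_def quad_functional_def)
    have L0: "L$a$b = 0" if "a \<noteq> b" "\<not> E a b" for a b using supp that by (simp add: supported_on_def)
    have Mnth: "M$a$b = L$a$b - inverse (L$i$i) * (L$a$i * L$b$i)" for a b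
      by (simp add: M_def col)
    have psdM: "psd M"
    proof -
      have "L *v axis i 1 \<noteq> 0" using col[of i] Lii by auto
      then show ?thesis
        using psd_split_outer(2)[OF psd, of "axis i 1"] by (simp add: M_def axis_inner_matrix_axis)
    qed
    have suppM: "supported_on ?F M"
      unfolding supported_on_def
    proof (intro allI impI)
      fix u w assume uw: "u \<noteq> w" "\<not> ?F u w"
      consider "u = i" | "w = i" | "u \<noteq> i" "w \<noteq> i" "\<not> E u w" "\<not> E i u \<or> \<not> E i w"
        using uw by (auto simp: eliminate_def)
      then show "M$u$w = 0"
      proof cases
        case 1 then show ?thesis using Lii Lsym[of w i] by (simp add: Mnth)
      next
        case 2 then show ?thesis using Lii by (simp add: Mnth)
      next
        case 3
        then have "L$u$w = 0" "L$u$i = 0 \<or> L$w$i = 0"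
          using L0[of u w] L0[of u i] L0[of w i] uw(1) sym[of u i] sym[of w i] by auto
        then show ?thesis by (auto simp: Mnth)
      qed
    qed
    have rankM: "rank M \<le> p"
      using rank_schur_complement_less(1)[OF psd Lii] Suc.prems(4) by (simp add: M_def)
    \<comment> \<open>Elimination can shorten a cycle by one; the rank drop lowers the length bound
      by the same amount.\<close>
    have cycM: "\<not> has_induced_cycle ?F k" if "4 \<le> k" "k \<le> p + 2" for k
      using has_induced_cycle_eliminateD[OF E, of i k] Suc.prems(5)[of k] Suc.prems(5)[of "k + 1"] that
      by auto
    \<comment> \<open>Since \<open>b\<close> is not adjacent to \<open>i\<close>, its diagonal entry
      is unchanged. It is the index outside the neighbourhood of \<open>i\<close> that the induction
      hypothesis asks for.\<close>
    have Mbb: "M$b$b \<noteq> 0" using b L0[of b i] sym[of b i] by (simp add: Mnth)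
    have "clique ?F {a. E i a}" using irr by (auto simp: clique_def eliminate_def)
    from Suc.IH[OF simple_graph_eliminate[OF E] psdM suppM rankM cycM this _ Mbb] b
    obtain y where y: "clique ?F {a. (M *v y)$a \<noteq> 0}" "\<not> {a. (M *v y)$a \<noteq> 0} \<subseteq> {a. E i a}"
      by auto
    obtain z where z: "M *v y = L *v z" using schur_complement_mult[of L _ _ y] M_def by metis
    define K where "K = {a. (L *v z)$a \<noteq> 0}"
    have iK: "i \<notin> K"
      using rank_schur_complement_less(2)[OF psd Lii, of y] z by (simp add: M_def K_def)
    obtain c where c: "c \<in> K" "\<not> E i c" using y(2) z K_def by auto
    have ci: "c \<noteq> i" using c iK by blast
    have FK: "?F u w" if "u \<in> K" "w \<in> K" "u \<noteq> w" for u w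
      using y(1) that z by (simp add: K_def clique_def)
    have "L$c$c \<noteq> 0" using c(1) diag by (simp add: K_def)
    then have "nonuniv c" using c(2) ci Lii sym[of c i]
      unfolding nonuniv_def by (auto intro!: exI[of _ i])
    have "c \<notin> C"
    proof
      assume "c \<in> C"
      then have "i \<in> C" using i(2) \<open>nonuniv c\<close> by blast
      then show False using \<open>c \<in> C\<close> c(2) ci Suc.prems(6) by (auto simp: clique_def)
    qed
    moreover have "clique E K"
      unfolding clique_def
    \<comment> \<open>A missing edge between \<open>u\<close> and \<open>w\<close> must be fill-in,
      so both are adjacent to \<open>i\<close>. As \<open>c\<close> is not, its edges to them are
      genuine, and \<open>i, u, c, w\<close> is an induced 4-cycle.\<close>
    proof (intro ballI impI, rule ccontr)
      fix u w assume uw: "u \<in> K" "w \<in> K" "u \<noteq> w" and nE: "\<not> E u w"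
      have "E i u" "E i w" using FK[OF uw] nE by (auto simp: eliminate_def)
      then have "c \<noteq> u" "c \<noteq> w" using c by auto
      then have "E u c" "E c w"
        using FK[OF uw(1) c(1)] FK[OF c(1) uw(2)] c(2) by (auto simp: eliminate_def)
      then have "has_induced_cycle E 4"
        using has_induced_4_cycleI[OF E, of i u c w] \<open>E i u\<close> \<open>E i w\<close> sym[of i w] c(2) ci nE uw(3) by simp
      \<comment> \<open>The 4-cycle is excluded only if \<open>4 \<le> Suc p + 2\<close>; for
        \<open>p = 0\<close> the complement \<open>M\<close> would be zero.\<close>
      moreover have "p \<noteq> 0"
      proof
        assume "p = 0"
        then have "M = 0" using rankM rank_le_0_imp_zero by simp
        then show False using Mbb by simp
      qed
      ultimately show False using Suc.prems(5)[of 4] by simp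
    qed
    ultimately show ?thesis using c(1) unfolding K_def by blast
  qed
qed

lemma extreme_ray_imp_induced_cycle:
  fixes E :: "'n::finite \<Rightarrow> 'n \<Rightarrow> bool"
  assumes E: "simple_graph E" and ext: "extreme_ray (sos_dual_cone E) L" and rank: "1 < rank L"
  shows "\<exists>k\<ge>4. k \<le> rank L + 2 \<and> has_induced_cycle E k"
proof (rule ccontr)
  assume no: "\<not> ?thesis"
  have psd: "psd L" and supp: "supported_on E L" and "L \<noteq> 0"
    and split: "\<And>A B. \<lbrakk>psd A; supported_on E A; psd B; supported_on E B; A + B = L\<rbrakk>
      \<Longrightarrow> \<exists>s\<ge>0. A = s *\<^sub>R L"
    using ext by (auto simp: extreme_ray_def mem_sos_dual_cone_iff)
  have "\<exists>j. L$j$j \<noteq> 0"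
  proof (rule ccontr)
    assume "\<nexists>j. L$j$j \<noteq> 0"
    then have "L *v f = 0" for f
      using psd_zero_diag_imp_zero_component[OF psd] by (simp add: vec_eq_iff)
    then show False using \<open>L \<noteq> 0\<close> by (simp add: matrix_eq)
  qed
  then obtain j where "L$j$j \<noteq> 0" by blast
  \<comment> \<open>With the empty clique for \<open>C\<close>, not being contained in
    \<open>C\<close> means being nonempty.\<close>
  then obtain y where y: "clique E {a. (L *v y)$a \<noteq> 0}" "{a. (L *v y)$a \<noteq> 0} \<noteq> {}"
    using psd_ex_clique_supported[OF E psd supp order_refl, of "{}" j] no by (auto simp: clique_def)
  let ?x = "L *v y"
  have x0: "?x \<noteq> 0" using y(2) by auto
  define c where "c = inverse (y \<bullet> ?x)"
  have c: "0 < c" and psdB: "psd (L - c *\<^sub>R outer ?x)"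
    using psd_split_outer[OF psd x0] by (auto simp: c_def)
  have suppA: "supported_on E (c *\<^sub>R outer ?x)"
    using y(1) by (auto simp: supported_on_def clique_def)
  then have "supported_on E (L - c *\<^sub>R outer ?x)"
    using supp by (auto simp: supported_on_def)
  then obtain s where s: "c *\<^sub>R outer ?x = s *\<^sub>R L"
    using split[OF psd_scaleR_outer suppA psdB] c by force
  have "outer ?x \<noteq> 0"
    using x0 by (metis inner_eq_zero_iff matrix_vector_mult_0 outer_mult scaleR_eq_0_iff)
  then have "s \<noteq> 0" using s c by auto
  then have "L = (c / s) *\<^sub>R outer ?x"
    using s by (metis divide_inverse_commute eq_vector_fraction_iff scaleR_scaleR vector_fraction_eq_iff)
  then have "range (\<lambda>f. L *v f) \<subseteq> span {?x}"
    by (smt (verit) image_subsetI outer_mult scaleR_matrix_vector_assoc span_base span_scale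
        insertI1)
  then have "rank L \<le> card {?x}"
    unfolding rank_dim_range by (rule dim_le_card) simp
  then show False using rank by simp
qed


section \<open>Extreme rays from induced cycles\<close>

lemma sum_outer_mult: "(\<Sum>k\<in>S. outer (q k)) *v f = (\<Sum>k\<in>S. (q k \<bullet> f) *\<^sub>R q k)"
  by (induction S rule: infinite_finite_induct)
    (simp_all add: matrix_vector_mult_add_rdistrib outer_mult)

lemma psd_sum_outer: "psd (\<Sum>k\<in>S. outer (q k))"
  unfolding psd_def quad_functional_def sum_outer_mult
  by (auto simp: inner_sum_right inner_commute mult.commute intro!: sum_nonneg)

text \<open>The dual family \<open>t\<close> shows both that the \<open>q k\<close> are independent
  and that each lies in the column space, as the image of \<open>t k\<close>.\<close>

lemma rank_sum_outer_biorthogonal: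
  fixes q t :: "nat \<Rightarrow> real^'n"
  assumes "\<And>k m. k < p \<Longrightarrow> m < p \<Longrightarrow> q k \<bullet> t m = of_bool (k = m)"
  shows "rank (\<Sum>k<p. outer (q k)) = p"
proof -
  let ?L = "\<Sum>k<p. outer (q k)"
  have inj: "inj_on q {..<p}"
    by (rule inj_onI) (metis assms lessThan_iff of_bool_eq_iff)
  have "q m = ?L *v t m" if "m < p" for m
    using that by (simp add: sum_outer_mult assms if_distrib[of "\<lambda>c. c *\<^sub>R _"] of_bool_def
        sum.delta cong: if_cong)
  then have "q ` {..<p} \<subseteq> range (\<lambda>f. ?L *v f)" by auto
  moreover have "subspace (range (\<lambda>f. ?L *v f))"
    by (simp add: linear_subspace_image matrix_vector_mul_linear)
  ultimately have "span (q ` {..<p}) \<subseteq> range (\<lambda>f. ?L *v f)" by (rule span_minimal)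
  moreover have "range (\<lambda>f. ?L *v f) \<subseteq> span (q ` {..<p})"
    unfolding sum_outer_mult by (intro image_subsetI span_sum span_scale span_base) auto
  ultimately have "range (\<lambda>f. ?L *v f) = span (q ` {..<p})" by blast
  moreover have "independent (q ` {..<p})"
  proof (rule independent_if_scalars_zero)
    fix g x assume g: "(\<Sum>x\<in>q ` {..<p}. g x *\<^sub>R x) = 0" and "x \<in> q ` {..<p}"
    then obtain m where m: "m < p" "x = q m" by blast
    have "0 = (\<Sum>x\<in>q ` {..<p}. g x *\<^sub>R x) \<bullet> t m" using g by simp
    also have "\<dots> = (\<Sum>k<p. g (q k) * (q k \<bullet> t m))"
      by (simp add: sum.reindex[OF inj] inner_sum_left)
    also have "\<dots> = g x"
      using m by (simp add: assms of_bool_def if_distrib[of "\<lambda>c. _ * c"] sum.delta cong: if_cong)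
    finally show "g x = 0" by simp
  qed simp
  ultimately show ?thesis
    by (simp add: rank_dim_range dim_eq_card_independent card_image[OF inj])
qed

text \<open>Two nonnegative values with sum zero both vanish, so \<open>f\<close> is isotropic for
  \<open>A\<close>.\<close>

lemma psd_summand_kernel:
  assumes "psd A" "psd B" "(A + B) *v f = 0"
  shows "A *v f = 0"
proof -
  have "f \<bullet> (A *v f) + f \<bullet> (B *v f) = 0"
    using assms(3) by (simp add: matrix_vector_mult_add_rdistrib inner_add_right[symmetric])
  moreover have "0 \<le> f \<bullet> (A *v f)" "0 \<le> f \<bullet> (B *v f)" using assms by (auto simp: psd_def)
  ultimately show ?thesis using psd_kernel_iff[OF assms(1)] by simp
qed

text \<open>The vertex \<open>c (p + 1)\<close> is singled out; the others form the induced path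
  \<open>c 0, ..., c p\<close>.\<close>

locale induced_cycle =
  fixes E :: "'n::finite \<Rightarrow> 'n \<Rightarrow> bool" and c :: "nat \<Rightarrow> 'n" and p :: nat
  assumes graph: "simple_graph E"
    and p: "2 \<le> p"
    and inj: "inj_on c {..<p + 2}"
    and adj: "\<And>i j. i < j \<Longrightarrow> j < p + 2 \<Longrightarrow> E (c i) (c j) \<longleftrightarrow> j = i + 1 \<or> i = 0 \<and> j = p + 1"
begin

definition cvec :: "(nat \<Rightarrow> real) \<Rightarrow> real^'n" where
  "cvec g = (\<Sum>i<p + 2. g i *\<^sub>R axis (c i) 1)"

lemma c_eq_iff: "i < p + 2 \<Longrightarrow> j < p + 2 \<Longrightarrow> c i = c j \<longleftrightarrow> i = j"
  using inj by (auto simp: inj_on_def)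

lemma cvec_nth:
  assumes "i < p + 2"
  shows "cvec g $ c i = g i"
proof -
  have "cvec g $ c i = (\<Sum>j<p + 2. if j = i then g i else 0)"
    unfolding cvec_def sum_component
    by (rule sum.cong) (use assms c_eq_iff[of i] in \<open>auto simp: axis_def\<close>)
  then show ?thesis using assms by simp
qed

lemma mult_cvec_nth: "(D *v cvec g) $ a = (\<Sum>i<p + 2. g i * D$a$c i)"
proof -
  have "D *v cvec g = (\<Sum>i<p + 2. g i *\<^sub>R (D *v axis (c i) 1))"
    unfolding cvec_def linear_sum[OF matrix_vector_mul_linear] matrix_vector_mult_scaleR ..
  then show ?thesis unfolding matrix_vector_mult_basis column_def sum_component by simp
qed

text \<open>In the sum of the squares over \<open>k < p\<close> the products
  \<open>x\<^sub>k x\<^sub>p\<^sub>+\<^sub>1\<close> with \<open>0 < k < p\<close> cancel, which leaves only edges of the cycle.\<close>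

definition q :: "nat \<Rightarrow> real^'n" where
  "q k = axis (c k) 1 - axis (c (k + 1)) 1 + axis (c (p + 1)) 1"

definition Q :: "real^'n^'n" where
  "Q = (\<Sum>k<p. outer (q k))"

lemma q_inner: "q k \<bullet> f = f $ c k - f $ c (k + 1) + f $ c (p + 1)"
  by (simp add: q_def inner_add_left inner_diff_left inner_axis')

lemma q_inner_cvec: "k < p \<Longrightarrow> q k \<bullet> cvec g = g k - g (k + 1) + g (p + 1)"
  by (simp add: q_inner cvec_nth)

lemma q_nth: "k < p \<Longrightarrow> i < p + 2 \<Longrightarrow>
    q k $ c i = of_bool (i = k) - of_bool (i = k + 1) + of_bool (i = p + 1)"
  using c_eq_iff[of i k] c_eq_iff[of i "k + 1"] c_eq_iff[of i "p + 1"]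
  by (auto simp: q_def axis_def)

lemma q_nth_outside: "k < p \<Longrightarrow> a \<notin> c ` {..<p + 2} \<Longrightarrow> q k $ a = 0"
  by (auto simp: q_def axis_def)

lemma Q_nth: "Q $ a $ b = (\<Sum>k<p. q k $ a * q k $ b)"
  by (simp add: Q_def)

lemma psd_Q: "psd Q"
  by (simp add: Q_def psd_sum_outer)

lemma rank_Q: "rank Q = p"
  unfolding Q_def
  \<comment> \<open>The dual vectors are indicators of initial segments of the path:
    \<open>q k\<close> sees only a drop from position \<open>k\<close> to \<open>k + 1\<close>, as
    the value at \<open>p + 1\<close> is \<open>0\<close>.\<close>
  by (rule rank_sum_outer_biorthogonal[where t = "\<lambda>m. cvec (\<lambda>i. of_bool (i \<le> m))"])
    (auto simp: q_inner_cvec)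

lemma supported_on_Q: "supported_on E Q"
proof -
  have sym: "E a b \<longleftrightarrow> E b a" for a b using graph by (auto simp: simple_graph_def)
  have inc: "Q $ c i $ c j = 0" if ij: "i < j" "j < p + 2" and nE: "\<not> E (c i) (c j)" for i j
  proof -
    have ne: "j \<noteq> i + 1" "\<not> (i = 0 \<and> j = p + 1)" using adj[OF ij] nE by auto
    show ?thesis
    proof (cases "j = p + 1")
      case False
      then have "q k $ c i * q k $ c j = 0" if "k < p" for k
        using that ij ne by (auto simp: q_nth)
      then show ?thesis unfolding Q_nth by (intro sum.neutral) simp
    next
      case True
      then have i: "0 < i" "i < p" using ij ne by auto
      \<comment> \<open>Position \<open>i\<close> occurs in \<open>q i\<close> with sign
        \<open>+\<close> and in \<open>q (i - 1)\<close> with sign \<open>-\<close>; both indices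
        are below \<open>p\<close>.\<close>
      have "Q $ c i $ c j = (\<Sum>k<p. of_bool (i = k) - of_bool (i = k + 1))"
        unfolding Q_nth by (rule sum.cong) (use True ij i in \<open>auto simp: q_nth\<close>)
      also have "\<dots> = (\<Sum>k<p. of_bool (i = k)) - (\<Sum>k<p. of_bool (k = i - 1))"
        unfolding sum_subtractf using i by (intro arg_cong2[of _ _ _ _ "(-)"] sum.cong) auto
      also have "\<dots> = 0" using i by (simp add: of_bool_def)
      finally show ?thesis .
    qed
  qed
  show ?thesis
    unfolding supported_on_def
  proof (intro allI impI)
    fix a b assume ab: "a \<noteq> b" "\<not> E a b"
    show "Q $ a $ b = 0"
    proof (cases "a \<in> c ` {..<p + 2} \<and> b \<in> c ` {..<p + 2}")
      case False
      then show ?thesis by (auto simp: Q_nth q_nth_outside)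
    next
      case True
      then obtain i j where ij: "a = c i" "b = c j" "i < p + 2" "j < p + 2" by auto
      then consider "i < j" | "j < i" using ab by fastforce
      then show ?thesis
      proof cases
        case 1 then show ?thesis using inc ij ab by simp
      next
        case 2 then show ?thesis
          using inc[of j i] ij ab sym psd_Q by (simp add: psd_def quad_functional_def)
      qed
    qed
  qed
qed

text \<open>On the cycle, all \<open>q k\<close> vanish exactly on arithmetic progressions along the
  path \<open>0, ..., p\<close> whose common difference is the value at \<open>p + 1\<close>. These
  two have differences \<open>0\<close> and \<open>1\<close>.\<close>

definition "ker_const = cvec (\<lambda>i. of_bool (i \<le> p))"
definition "ker_lin = cvec (\<lambda>i. if i = p + 1 then 1 else real i)"

lemma Q_kernel:
  "Q *v ker_const = 0" "Q *v ker_lin = 0" "a \<notin> c ` {..<p + 2} \<Longrightarrow> Q *v axis a 1 = 0"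
proof -
  have zero: "Q *v f = 0" if "\<And>k. k < p \<Longrightarrow> q k \<bullet> f = 0" for f
    unfolding Q_def sum_outer_mult by (rule sum.neutral) (simp add: that)
  show "Q *v ker_const = 0" by (rule zero) (simp add: ker_const_def q_inner_cvec)
  show "Q *v ker_lin = 0" by (rule zero) (simp add: ker_lin_def q_inner_cvec)
  show "Q *v axis a 1 = 0" if "a \<notin> c ` {..<p + 2}"
    by (rule zero) (simp add: inner_axis q_nth_outside[OF _ that])
qed

lemma Q_00: "Q $ c 0 $ c 0 = 1"
proof -
  have "Q $ c 0 $ c 0 = (\<Sum>k<p. if k = 0 then 1 else 0)"
    unfolding Q_nth by (rule sum.cong) (auto simp: q_nth)
  then show ?thesis using p by simp
qed

text \<open>The kernel of \<open>Q\<close> determines every matrix with the same support up to a scalar: in each row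
  the two kernel vectors leave one degree of freedom, which symmetry carries to the next row.\<close>

lemma eq_0_if_kernel:
  assumes sym: "quad_functional D" and supp: "supported_on E D"
    and ker: "D *v ker_const = 0" "D *v ker_lin = 0"
    and out: "\<And>a. a \<notin> c ` {..<p + 2} \<Longrightarrow> D *v axis a 1 = 0"
    and D00: "D $ c 0 $ c 0 = 0"
  shows "D = 0"
proof -
  define d where "d i j = D $ c i $ c j" for i j
  have dsym: "d i j = d j i" for i j using sym by (simp add: d_def quad_functional_def)
  have nonadj: "d i j = 0" if "i < j" "j < p + 2" "j \<noteq> i + 1" "i \<noteq> 0 \<or> j \<noteq> p + 1" for i j
    using supp adj[OF that(1,2)] c_eq_iff[of i j] that by (simp add: d_def supported_on_def)
  have lin: "(\<Sum>j<p + 2. of_bool (j \<le> p) * d i j) = 0"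
    "(\<Sum>j<p + 2. (if j = p + 1 then 1 else real j) * d i j) = 0" for i
    unfolding d_def using ker unfolding ker_const_def ker_lin_def
    by (simp_all only: mult_cvec_nth[symmetric] zero_index)
  have row0: "(\<Sum>j<p + 2. h j * d 0 j) = h 0 * d 0 0 + h 1 * d 0 1 + h (p + 1) * d 0 (p + 1)" for h
  proof -
    have "(\<Sum>j<p + 2. h j * d 0 j) = (\<Sum>j\<in>{0, 1, p + 1}. h j * d 0 j)"
      by (rule sum.mono_neutral_right) (use nonadj[of 0] in auto)
    then show ?thesis using p by simp
  qed
  have rowi: "(\<Sum>j<p + 2. h j * d i j)
      = h (i - 1) * d i (i - 1) + h i * d i i + h (i + 1) * d i (i + 1)"
    if i: "0 < i" "i \<le> p" for h i
  proof -
    have "d i j = 0" if "j < p + 2" "j \<notin> {i - 1, i, i + 1}" for j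
      using nonadj[of i j] nonadj[of j i] dsym[of i j] that i by (cases "i < j") auto
    then have "(\<Sum>j<p + 2. h j * d i j) = (\<Sum>j\<in>{i - 1, i, i + 1}. h j * d i j)"
      by (intro sum.mono_neutral_right) (use i in auto)
    also have "\<dots> = h (i - 1) * d i (i - 1) + h i * d i i + h (i + 1) * d i (i + 1)"
      using i(1) by (cases i) simp_all
    finally show ?thesis .
  qed
  have rowp: "(\<Sum>j<p + 2. h j * d (p + 1) j)
      = h 0 * d (p + 1) 0 + h p * d (p + 1) p + h (p + 1) * d (p + 1) (p + 1)" for h
  proof -
    have "d (p + 1) j = 0" if "j < p + 2" "j \<notin> {0, p, p + 1}" for j
      using nonadj[of j "p + 1"] dsym[of j "p + 1"] that by auto
    then have "(\<Sum>j<p + 2. h j * d (p + 1) j) = (\<Sum>j\<in>{0, p, p + 1}. h j * d (p + 1) j)"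
      by (intro sum.mono_neutral_right) auto
    then show ?thesis using p by simp
  qed
  have d00: "d 0 0 = 0" using D00 by (simp add: d_def)
  \<comment> \<open>\<open>ker_const\<close> has weight \<open>0\<close> at \<open>p + 1\<close> and
    so gives the first equation; \<open>ker_lin\<close> then gives the second.\<close>
  have d01: "d 0 1 = 0" and d0y: "d 0 (p + 1) = 0"
    using lin[of 0] p unfolding row0 by (auto simp: d00)
  have step: "d i i = 0 \<and> d i (i + 1) = 0" if "i \<le> p" for i
    using that
  proof (induction i)
    case 0
    then show ?case using d00 d01 by simp
  next
    case (Suc i)
    then have "d (Suc i) i = 0" using dsym[of i "Suc i"] by simp
    then have eqs: "of_bool (Suc i \<le> p) * d (Suc i) (Suc i)
        + of_bool (Suc i + 1 \<le> p) * d (Suc i) (Suc i + 1) = 0"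
      "(if Suc i = p + 1 then 1 else real (Suc i)) * d (Suc i) (Suc i)
        + (if Suc i + 1 = p + 1 then 1 else real (Suc i + 1)) * d (Suc i) (Suc i + 1) = 0"
      using lin[of "Suc i"] unfolding rowi[OF zero_less_Suc Suc.prems] by simp_all
    \<comment> \<open>Two unknowns remain in the row. For \<open>Suc i < p\<close> the weights
      \<open>1, 1\<close> and \<open>i + 1, i + 2\<close> are independent. For
      \<open>Suc i = p\<close> the next position is \<open>p + 1\<close>, with weights
      \<open>0\<close> and \<open>1\<close>, and the system is triangular.\<close>
    show ?case
    proof (cases "Suc i = p")
      case True
      then show ?thesis using eqs by simp
    next
      case False
      then have "d (Suc i) (Suc i) = - d (Suc i) (Suc i + 1)"
        using eqs(1) Suc.prems by simp
      moreover have "(real i + 1) * d (Suc i) (Suc i) + (real i + 2) * d (Suc i) (Suc i + 1) = 0"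
        using eqs(2) Suc.prems False by (simp add: algebra_simps)
      ultimately show ?thesis by (simp add: algebra_simps)
    qed
  qed
  \<comment> \<open>Only the diagonal entry of the last row is left; \<open>ker_lin\<close> gives it
    weight \<open>1\<close>.\<close>
  have "d (p + 1) (p + 1) = 0"
    using lin(2)[of "p + 1"] step[of p] dsym[of p "p + 1"] d0y dsym[of 0 "p + 1"] unfolding rowp by simp
  have d0: "d i j = 0" if "i \<le> j" "j < p + 2" for i j
  proof (cases "j = i \<or> j = i + 1")
    case True
    show ?thesis
    proof (cases "i \<le> p")
      case True
      then show ?thesis using step[of i] \<open>j = i \<or> j = i + 1\<close> by auto
    next
      case False
      then have "i = p + 1" "j = p + 1" using that by simp_all
      then show ?thesis using \<open>d (p + 1) (p + 1) = 0\<close> by simp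
    qed
  next
    case False
    then show ?thesis
      using that d0y nonadj[of i j] by (cases "i = 0 \<and> j = p + 1") simp_all
  qed
  have "D $ a $ b = 0" for a b
  proof (cases "a \<in> c ` {..<p + 2} \<and> b \<in> c ` {..<p + 2}")
    case True
    then obtain i j where "a = c i" "b = c j" "i < p + 2" "j < p + 2" by auto
    then show ?thesis
      using d0[of i j] d0[of j i] dsym[of i j] by (cases "i \<le> j") (auto simp: d_def)
  next
    case False
    have "D $ u $ w = 0" if "w \<notin> c ` {..<p + 2}" for u w
      using out[OF that] axis_inner_matrix_axis[of u D w] by simp
    then show ?thesis using False sym unfolding quad_functional_def by metis
  qed
  then show ?thesis by (simp add: vec_eq_iff)
qed

text \<open>\<open>A\<close> inherits the kernel of \<open>Q\<close>. Since \<open>Q\<close> has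
  entry \<open>1\<close> at \<open>c 0\<close>, subtracting \<open>s\<close> times \<open>Q\<close>
  clears that entry, and \<open>eq_0_if_kernel\<close> applies to the difference.\<close>

lemma summand_Q:
  assumes "psd A" "supported_on E A" "psd B" "A + B = Q"
  shows "\<exists>s\<ge>0. A = s *\<^sub>R Q"
proof (intro exI conjI)
  define s where "s = A $ c 0 $ c 0"
  show "0 \<le> s" using psd_diag_nonneg[OF assms(1)] by (simp add: s_def)
  have ker: "(A - s *\<^sub>R Q) *v f = 0" if "Q *v f = 0" for f
    using psd_summand_kernel[OF assms(1,3), of f] that assms(4)
    by (simp add: matrix_vector_mult_diff_rdistrib scaleR_matrix_vector_assoc[symmetric])
  have "A - s *\<^sub>R Q = 0"
  proof (rule eq_0_if_kernel)
    show "quad_functional (A - s *\<^sub>R Q)"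
      using assms(1) psd_Q by (simp add: psd_def quad_functional_def)
    show "supported_on E (A - s *\<^sub>R Q)"
      using assms(2) supported_on_Q by (simp add: supported_on_def)
    show "(A - s *\<^sub>R Q) $ c 0 $ c 0 = 0" by (simp add: Q_00 s_def)
  qed (rule ker, rule Q_kernel, assumption?)+
  then show "A = s *\<^sub>R Q" by simp
qed

lemma extreme_ray_Q: "extreme_ray (sos_dual_cone E) Q"
proof -
  have "(\<exists>s\<ge>0. A = s *\<^sub>R Q) \<and> (\<exists>t\<ge>0. B = t *\<^sub>R Q)"
    if "psd A \<and> supported_on E A" "psd B \<and> supported_on E B" "A + B = Q" for A B
    using that summand_Q[of A B] summand_Q[of B A] by (simp add: add.commute)
  moreover have "Q \<noteq> 0" using Q_00 by auto
  ultimately show ?thesis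
    unfolding extreme_ray_def Ball_def mem_sos_dual_cone_iff using psd_Q supported_on_Q by simp
qed

end

lemma induced_cycle_imp_extreme_ray:
  assumes "simple_graph E" "2 \<le> p" "has_induced_cycle E (p + 2)"
  shows "\<exists>L. extreme_ray (sos_dual_cone E) L \<and> rank L = p"
proof -
  obtain c where c: "inj_on c {..<p + 2}"
    "\<forall>i j. i < j \<longrightarrow> j < p + 2 \<longrightarrow> (E (c i) (c j) \<longleftrightarrow> j = i + 1 \<or> i = 0 \<and> j = p + 2 - 1)"
    using assms(3) unfolding has_induced_cycle_iff_increasing[OF assms(1)] by blast
  interpret induced_cycle E c p
  proof
    show "E (c i) (c j) \<longleftrightarrow> j = i + 1 \<or> i = 0 \<and> j = p + 1" if "i < j" "j < p + 2" for i j
      using c(2)[rule_format, OF that] by simp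
  qed (fact assms c)+
  have "extreme_ray (sos_dual_cone E) Q \<and> rank Q = p"
    by (rule conjI[OF extreme_ray_Q rank_Q])
  then show ?thesis ..
qed

section \<open>Equality of the two minima\<close>

theorem theorem6p5:
  fixes E :: "'n::finite \<Rightarrow> 'n \<Rightarrow> bool"
  assumes "simple_graph E"
  shows "hankel_index E =
    (if \<exists>p\<ge>2. has_induced_cycle E (p + 2)
     then enat (LEAST p. p \<ge> 2 \<and> has_induced_cycle E (p + 2))
     else \<infinity>)"
proof -
  define P where "P p \<longleftrightarrow> p > 1 \<and> (\<exists>L. extreme_ray (sos_dual_cone E) L \<and> functional_rank L = p)" for p
  define R where "R p \<longleftrightarrow> p \<ge> 2 \<and> has_induced_cycle E (p + 2)" for p
  have RP: "P p" if "R p" for p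
    using induced_cycle_imp_extreme_ray[OF assms] that by (auto simp: P_def R_def functional_rank_def)
  \<comment> \<open>A ray of rank \<open>p\<close> yields a cycle of length at most
    \<open>p + 2\<close>, perhaps shorter; this still makes the least values agree.\<close>
  have PR: "\<exists>r\<le>p. R r" if "P p" for p
  proof -
    obtain k where k: "4 \<le> k" "k \<le> p + 2" "has_induced_cycle E k"
      using extreme_ray_imp_induced_cycle[OF assms] \<open>P p\<close> by (auto simp: P_def functional_rank_def)
    define r where "r = k - 2"
    have "k = r + 2" using k(1) by (simp add: r_def)
    then show ?thesis using k by (auto simp: R_def)
  qed
  have ex: "(\<exists>p. P p) \<longleftrightarrow> (\<exists>p. R p)" using RP PR by blast
  have "(LEAST p. P p) = (LEAST p. R p)" if "\<exists>p. R p"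
  proof (rule antisym)
    show "(LEAST p. P p) \<le> (LEAST p. R p)"
      using that RP by (meson LeastI_ex Least_le)
    show "(LEAST p. R p) \<le> (LEAST p. P p)"
      using that ex PR by (meson LeastI_ex Least_le order_trans)
  qed
  then show ?thesis
    using ex unfolding hankel_index_def P_def[symmetric] R_def[symmetric] by auto
qed

end
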